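(* Let $n\in\omega$, $n\geq 2$, let $X$ be an $n$-Hausdorff space and let $Y=n\text{-}\kappa X$ be the simple $n$-H-closed extension of $X$ described in the context. If $Z$ is an $n$-H-closed extension of $X$, then there is a continuous surjection $f:Y\to Z$ such that $f(x)=x$ for all $x\in X$.
   Context: Spaces are arbitrary topological spaces. A space $X$ is $n$-Hausdorff if for any distinct points $x_1,\dots,x_n\in X$ there are open sets $U_i\ni x_i$ with $\bigcap_{i=1}^n U_i=\varnothing$. An $n$-Hausdorff space is $n$-H-closed if it is closed in every $n$-Hausdorff space in which it is embedded. An extension of $X$ is a space containing $X$ as a dense subspace. An open filter on $X$ is a nonempty family of nonempty open subsets closed under finite intersections and open supersets; an open ultrafilter is a maximal open filter. The adherence of $\mathcal F$ is $a\mathcal F=\bigcap_{F\in\mathcal F}\mathrm{cl}_X(F)$. Construction of $n\text{-}\kappa X$: let $\{\mathcal U_\alpha:\alpha\in|\mathfrak U|\}$ be a one-to-one indexing of the set $\mathfrak U$ of all open ultrafilters $\mathcal U$ on $X$ with $|a\mathcal U|<n-1$. For each $\alpha$ let $k\alpha=n-1-|a\mathcal U_\alpha|$ and let $p_{\alpha i}$ ($1\leq i\leq k\alpha$) be points, all distinct (over all $\alpha,i$) and not in $X$. Put $Y=X\cup\{p_{\alpha i}:\alpha\in|\mathfrak U|,\,1\leq i\leq k\alpha\}$. A set $V\subseteq Y$ is open iff $V\cap X$ is open in $X$ and, whenever $p_{\alpha i}\in V$, $V\cap X\in\mathcal U_\alpha$. This $Y$ is an $n$-H-closed extension of $X$.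 *)

theory Defs
  imports "HOL-Analysis.Analysis"
begin

definition n_Hausdorff :: "nat \<Rightarrow> 'a topology \<Rightarrow> bool" where
  "n_Hausdorff n X \<longleftrightarrow>
     (\<forall>x. x ` {1..n} \<subseteq> topspace X \<and> inj_on x {1..n} \<longrightarrow>
       (\<exists>U. (\<forall>i\<in>{1..n}. openin X (U i) \<and> x i \<in> U i) \<and> (\<Inter>i\<in>{1..n}. U i) = {}))"

text \<open>
  A definition cannot quantify over all spaces of all types, so the ambient spaces \<open>W\<close> range
  over topologies on \<^typ>\<open>'a option\<close>. This loses nothing: if an embedded copy of \<open>X\<close> is not
  closed in some \<open>n\<close>-Hausdorff space, then it is not closed in the subspace obtained by adding a
  single point of its closure, and that subspace has a copy on \<^typ>\<open>'a option\<close>. The lemma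
  \<open>n_H_closed_closedin\<close> below gives closedness in \<open>n\<close>-Hausdorff spaces of arbitrary type.
\<close>

definition n_H_closed :: "nat \<Rightarrow> 'a topology \<Rightarrow> bool" where
  "n_H_closed n X \<longleftrightarrow>
     n_Hausdorff n X \<and>
     (\<forall>(W :: 'a option topology) e. n_Hausdorff n W \<and> embedding_map X W e
        \<longrightarrow> closedin W (e ` topspace X))"

text \<open>\<open>X\<close> is identified with its image under the embedding \<open>j\<close>.\<close>

definition extension_via :: "'a topology \<Rightarrow> 'b topology \<Rightarrow> ('a \<Rightarrow> 'b) \<Rightarrow> bool" where
  "extension_via X Z j \<longleftrightarrow> embedding_map X Z j \<and> Z closure_of (j ` topspace X) = topspace Z"

definition open_filter :: "'a topology \<Rightarrow> 'a set set \<Rightarrow> bool" where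
  "open_filter X F \<longleftrightarrow>
     F \<noteq> {} \<and> (\<forall>U\<in>F. openin X U \<and> U \<noteq> {}) \<and>
     (\<forall>U\<in>F. \<forall>V\<in>F. U \<inter> V \<in> F) \<and>
     (\<forall>U\<in>F. \<forall>V. openin X V \<and> U \<subseteq> V \<longrightarrow> V \<in> F)"

definition open_ultrafilter :: "'a topology \<Rightarrow> 'a set set \<Rightarrow> bool" where
  "open_ultrafilter X F \<longleftrightarrow>
     open_filter X F \<and> (\<forall>G. open_filter X G \<and> F \<subseteq> G \<longrightarrow> G = F)"

definition adherence :: "'a topology \<Rightarrow> 'a set set \<Rightarrow> 'a set" where
  "adherence X F = (\<Inter>U\<in>F. X closure_of U)"

text \<open>Finiteness is required explicitly because \<^const>\<open>card\<close> is \<open>0\<close> on infinite sets.\<close>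

definition small_ultrafilters :: "nat \<Rightarrow> 'a topology \<Rightarrow> 'a set set set" where
  "small_ultrafilters n X =
     {F. open_ultrafilter X F \<and> finite (adherence X F) \<and> card (adherence X F) < n - 1}"

text \<open>
  The ultrafilters index themselves: the point \<open>p\<^sub>\<alpha>\<^sub>i\<close> attached to the ultrafilter \<open>F\<close> is
  \<open>Inr (F, i)\<close>, and a point \<open>x\<close> of \<open>X\<close> is \<open>Inl x\<close>. Thus \<open>Inl -` V\<close> is the trace of \<open>V\<close> on \<open>X\<close>.
\<close>

type_synonym 'a kappa = "'a + 'a set set \<times> nat"

definition n_kappa_points :: "nat \<Rightarrow> 'a topology \<Rightarrow> 'a kappa set" where
  "n_kappa_points n X =
     Inl ` topspace X \<union>
     {Inr (F, i) | F i. F \<in> small_ultrafilters n X \<and> i \<in> {1..n - 1 - card (adherence X F)}}"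

definition n_kappa :: "nat \<Rightarrow> 'a topology \<Rightarrow> 'a kappa topology" where
  "n_kappa n X = topology (\<lambda>V. V \<subseteq> n_kappa_points n X \<and> openin X (Inl -` V) \<and>
     (\<forall>F i. Inr (F, i) \<in> V \<longrightarrow> Inl -` V \<in> F))"

lemma open_filter_Int: "open_filter X F \<Longrightarrow> U \<in> F \<Longrightarrow> V \<in> F \<Longrightarrow> U \<inter> V \<in> F"
  unfolding open_filter_def by blast

lemma open_filter_superset:
  "open_filter X F \<Longrightarrow> U \<in> F \<Longrightarrow> openin X V \<Longrightarrow> U \<subseteq> V \<Longrightarrow> V \<in> F"
  unfolding open_filter_def by blast

lemma openin_n_kappa:
  "openin (n_kappa n X) V \<longleftrightarrow>
     V \<subseteq> n_kappa_points n X \<and> openin X (Inl -` V) \<and>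
     (\<forall>F i. Inr (F, i) \<in> V \<longrightarrow> Inl -` V \<in> F)"
proof -
  have filt: "open_filter X F" if "Inr (F, i) \<in> n_kappa_points n X" for F i
    using that by (auto simp: n_kappa_points_def small_ultrafilters_def open_ultrafilter_def)
  have "istopology (\<lambda>V. V \<subseteq> n_kappa_points n X \<and> openin X (Inl -` V) \<and>
     (\<forall>F i. Inr (F, i) \<in> V \<longrightarrow> Inl -` V \<in> F))" (is "istopology ?P")
    unfolding istopology_def
  proof (intro conjI allI impI)
    fix S T assume S: "?P S" and T: "?P T"
    show "S \<inter> T \<subseteq> n_kappa_points n X" using S by blast
    show "openin X (Inl -` (S \<inter> T))" using S T by (simp add: openin_Int)
    fix F i assume "Inr (F, i) \<in> S \<inter> T"
    then have "open_filter X F" "Inl -` S \<in> F" "Inl -` T \<in> F" using S T filt by blast+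
    then show "Inl -` (S \<inter> T) \<in> F" unfolding vimage_Int by (rule open_filter_Int)
  next
    fix \<K> assume K: "\<forall>V\<in>\<K>. ?P V"
    show "\<Union>\<K> \<subseteq> n_kappa_points n X" using K by blast
    show op: "openin X (Inl -` \<Union>\<K>)" unfolding vimage_Union using K by (intro openin_Union) blast
    fix F i assume "Inr (F, i) \<in> \<Union>\<K>"
    then obtain V where V: "V \<in> \<K>" "Inr (F, i) \<in> V" by blast
    then have "open_filter X F" "Inl -` V \<in> F" "Inl -` V \<subseteq> Inl -` \<Union>\<K>" using K filt by blast+
    then show "Inl -` \<Union>\<K> \<in> F" using op open_filter_superset by blast
  qed
  then show ?thesis unfolding n_kappa_def by (simp add: topology_inverse')
qed

lemma topspace_n_kappa: "topspace (n_kappa n X) = n_kappa_points n X"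
proof (rule antisym)
  show "topspace (n_kappa n X) \<subseteq> n_kappa_points n X"
    using openin_n_kappa openin_topspace by blast
  have tr: "Inl -` n_kappa_points n X = topspace X" by (auto simp: n_kappa_points_def)
  have "topspace X \<in> F" if "Inr (F, i) \<in> n_kappa_points n X" for F i
  proof -
    have F: "open_filter X F"
      using that by (auto simp: n_kappa_points_def small_ultrafilters_def open_ultrafilter_def)
    then obtain U where "U \<in> F" "openin X U" by (auto simp: open_filter_def)
    then show ?thesis
      using open_filter_superset[OF F] openin_topspace openin_subset by blast
  qed
  then have "openin (n_kappa n X) (n_kappa_points n X)"
    by (simp add: openin_n_kappa tr)
  then show "n_kappa_points n X \<subseteq> topspace (n_kappa n X)" by (rule openin_subset)
qed

lemma n_H_closed_closedin:
  fixes X :: "'a topology" and W :: "'b topology"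
  assumes X: "n_H_closed n X" and W: "n_Hausdorff n W" and e: "embedding_map X W e"
  shows "closedin W (e ` topspace X)"
proof (rule ccontr)
  assume "\<not> closedin W (e ` topspace X)"
  moreover have cont: "continuous_map X W e"
    using e continuous_map_in_subtopology homeomorphic_imp_continuous_map
    unfolding embedding_map_def by blast
  then have sub: "e ` topspace X \<subseteq> topspace W"
    by (simp add: continuous_map_image_subset_topspace)
  ultimately have "\<not> W closure_of (e ` topspace X) \<subseteq> e ` topspace X"
    using closure_of_subset_eq by blast
  then obtain p where p: "p \<in> W closure_of (e ` topspace X)" "p \<notin> e ` topspace X" by blast
  have pW: "p \<in> topspace W" using p(1) by (simp add: in_closure_of)
  have hom: "homeomorphic_map X (subtopology W (e ` topspace X)) e"
    using e by (simp add: embedding_map_def)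
  have inj: "inj_on e (topspace X)"
    using homeomorphic_imp_injective_map[OF hom] .
  define A where "A = insert None (Some ` topspace X)"
  define g where "g = case_option p e"
  define W' where "W' = pullback_topology A g W"
  have gA: "g ` A \<subseteq> topspace W" using sub pW by (auto simp: A_def g_def)
  have inj_g: "inj_on g A"
    unfolding inj_on_def
  proof (intro ballI impI)
    fix y z assume "y \<in> A" "z \<in> A" "g y = g z"
    then show "y = z"
      using inj_onD[OF inj] p(2) by (cases y; cases z) (auto simp: A_def g_def)
  qed
  have top: "topspace W' = A"
    using gA by (auto simp: W'_def topspace_pullback_topology)
  have op: "openin W' (g -` T \<inter> A)" if "openin W T" for T
    using that by (auto simp: W'_def openin_pullback_topology)
  have "n_Hausdorff n W'"
    unfolding n_Hausdorff_def
  proof (intro allI impI)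
    fix x assume x: "x ` {1..n} \<subseteq> topspace W' \<and> inj_on x {1..n}"
    then have "(g \<circ> x) ` {1..n} \<subseteq> topspace W" using x gA top by (auto simp: image_subset_iff)
    moreover have "inj_on (g \<circ> x) {1..n}"
      using x inj_on_subset[OF inj_g] top by (intro comp_inj_on) simp_all
    ultimately obtain U where U: "\<forall>i\<in>{1..n}. openin W (U i) \<and> (g \<circ> x) i \<in> U i"
        "(\<Inter>i\<in>{1..n}. U i) = {}"
      using W[unfolded n_Hausdorff_def, rule_format, of "g \<circ> x"] by blast
    have "openin W' (g -` U i \<inter> A) \<and> x i \<in> g -` U i \<inter> A" if "i \<in> {1..n}" for i
    proof -
      have "openin W (U i)" "g (x i) \<in> U i" using U(1) that by simp_all
      moreover have "x i \<in> A" using x that top by blast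
      ultimately show ?thesis using op by simp
    qed
    moreover have "(\<Inter>i\<in>{1..n}. g -` U i \<inter> A) = {}"
    proof (rule ccontr)
      assume "(\<Inter>i\<in>{1..n}. g -` U i \<inter> A) \<noteq> {}"
      then obtain z where "\<forall>i\<in>{1..n}. g z \<in> U i" by blast
      then have "g z \<in> (\<Inter>i\<in>{1..n}. U i)" by blast
      then show False using U(2) by blast
    qed
    ultimately show "\<exists>U. (\<forall>i\<in>{1..n}. openin W' (U i) \<and> x i \<in> U i) \<and> (\<Inter>i\<in>{1..n}. U i) = {}"
      by (intro exI[of _ "\<lambda>i. g -` U i \<inter> A"]) blast
  qed
  moreover have "embedding_map X W' Some"
    unfolding embedding_map_def
  proof (rule bijective_open_imp_homeomorphic_map)
    show "continuous_map X (subtopology W' (Some ` topspace X)) Some"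
      unfolding continuous_map_in_subtopology
    proof
      show "continuous_map X W' Some"
        unfolding continuous_map
      proof (intro conjI allI impI)
        show "Some ` topspace X \<subseteq> topspace W'" by (auto simp: top A_def)
        fix V assume "openin W' V"
        then obtain T where T: "openin W T" "V = g -` T \<inter> A"
          by (auto simp: W'_def openin_pullback_topology)
        have "{x \<in> topspace X. Some x \<in> V} = {x \<in> topspace X. e x \<in> T}"
          by (auto simp: T(2) g_def A_def)
        then show "openin X {x \<in> topspace X. Some x \<in> V}"
          using cont T(1) by (simp add: continuous_map)
      qed
    qed auto
    show "open_map X (subtopology W' (Some ` topspace X)) Some"
      unfolding open_map_def
    proof (intro allI impI)
      fix V assume V: "openin X V"
      then have "openin (subtopology W (e ` topspace X)) (e ` V)"
        using hom homeomorphic_imp_open_map open_map_def by blast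
      then obtain T where T: "openin W T" "e ` V = T \<inter> e ` topspace X"
        by (auto simp: openin_subtopology)
      have "Some ` V = (g -` T \<inter> A) \<inter> Some ` topspace X"
      proof -
        have "x \<in> V \<longleftrightarrow> e x \<in> T" if "x \<in> topspace X" for x
        proof
          assume "e x \<in> T"
          then have "e x \<in> e ` V" using that T(2) by simp
          then obtain y where "y \<in> V" "e x = e y" by blast
          then show "x \<in> V" using inj_onD[OF inj] that openin_subset[OF V] by blast
        next
          assume "x \<in> V"
          then have "e x \<in> T \<inter> e ` topspace X" using T(2) by blast
          then show "e x \<in> T" by blast
        qed
        then show ?thesis using openin_subset[OF V] by (auto simp: g_def A_def)
      qed
      then show "openin (subtopology W' (Some ` topspace X)) (Some ` V)"
        using op[OF T(1)] unfolding openin_subtopology by blast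
    qed
    show "Some ` topspace X = topspace (subtopology W' (Some ` topspace X))"
      by (auto simp: top A_def)
  qed simp
  ultimately have "closedin W' (Some ` topspace X)"
    using X unfolding n_H_closed_def by blast
  then have "openin W' (A - Some ` topspace X)"
    using top by (metis openin_diff openin_topspace)
  moreover have "A - Some ` topspace X = {None}" by (auto simp: A_def)
  ultimately obtain T where T: "openin W T" "{None} = g -` T \<inter> A"
    by (auto simp: W'_def openin_pullback_topology)
  have "g None \<in> T" using T(2) by blast
  then have "p \<in> T" by (simp add: g_def)
  then obtain y where "y \<in> topspace X" "e y \<in> T" using p(1) T(1) by (auto simp: in_closure_of)
  then have "Some y \<in> g -` T \<inter> A" by (auto simp: g_def A_def)
  then show False using T(2) by blast
qed

end

theory Submission
  imports Defs
begin

text \<open>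
  Since \<open>X\<close> is dense in \<open>Z\<close>, open ultrafilters on \<open>X\<close> and on \<open>Z\<close> correspond to each other via
  traces, and the adherence on \<open>X\<close> is the trace of the adherence on \<open>Z\<close>. On an \<open>n\<close>-H-closed space
  every open ultrafilter has exactly \<open>n - 1\<close> adherent points: \<open>n\<close> of them would contradict the
  \<open>n\<close>-Hausdorff property, and with fewer the ultrafilter could be added as a new point. So the
  adherence on \<open>Z\<close> of an open ultrafilter \<open>F\<close> on \<open>X\<close> has \<open>n - 1 - |aF|\<close> points outside \<open>X\<close>, and \<open>f\<close>
  maps the new points attached to \<open>F\<close> bijectively onto them. Surjectivity holds because each point
  of \<open>Z\<close> adheres to some open ultrafilter, namely any one refining its neighbourhoods.
\<close>

section \<open>Open ultrafilters\<close>

lemma open_filter_openin: "open_filter X F \<Longrightarrow> U \<in> F \<Longrightarrow> openin X U"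
  unfolding open_filter_def by blast

lemma open_filter_nonempty: "open_filter X F \<Longrightarrow> U \<in> F \<Longrightarrow> U \<noteq> {}"
  unfolding open_filter_def by blast

lemma open_filter_topspace:
  assumes F: "open_filter X F"
  shows "topspace X \<in> F"
proof -
  obtain U where U: "U \<in> F" using F by (auto simp: open_filter_def)
  have "U \<subseteq> topspace X" using open_filter_openin[OF F U] by (rule openin_subset)
  then show ?thesis using open_filter_superset[OF F U] by simp
qed

lemma open_filter_Inter:
  assumes "open_filter X F" "finite I" "I \<noteq> {}" "\<And>i. i \<in> I \<Longrightarrow> U i \<in> F"
  shows "(\<Inter>i\<in>I. U i) \<in> F"
  using assms(2-4)
proof (induction I rule: finite_ne_induct)
  case (insert i I)
  then show ?case using open_filter_Int[OF assms(1)] by simp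
qed simp

lemma open_ultrafilter_imp_open_filter: "open_ultrafilter X F \<Longrightarrow> open_filter X F"
  unfolding open_ultrafilter_def by blast

text \<open>The open supersets of the sets \<open>U \<inter> V\<close> with \<open>U \<in> F\<close>
  form an open filter, proper because \<open>V\<close> meets every member of \<open>F\<close>. It
  contains both \<open>F\<close> and \<open>V\<close>, so maximality of \<open>F\<close> gives the
  claim.\<close>

lemma open_ultrafilter_memI:
  assumes F: "open_ultrafilter X F" and V: "openin X V" and meets: "\<And>U. U \<in> F \<Longrightarrow> U \<inter> V \<noteq> {}"
  shows "V \<in> F"
proof -
  note filt = open_ultrafilter_imp_open_filter[OF F]
  define G where "G = {W. openin X W \<and> (\<exists>U\<in>F. U \<inter> V \<subseteq> W)}"
  have top: "topspace X \<in> F" using open_filter_topspace[OF filt] .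
  have "open_filter X G"
    unfolding open_filter_def
  proof (intro conjI ballI allI impI)
    show "G \<noteq> {}" using top V by (auto simp: G_def)
    show "openin X W" "W \<noteq> {}" if "W \<in> G" for W
      using that meets by (auto simp: G_def)
    show "W \<inter> W' \<in> G" if W: "W \<in> G" "W' \<in> G" for W W'
    proof -
      obtain U U' where U: "U \<in> F" "U \<inter> V \<subseteq> W" "U' \<in> F" "U' \<inter> V \<subseteq> W'"
        using W by (auto simp: G_def)
      moreover have "U \<inter> U' \<in> F" using U open_filter_Int[OF filt] by blast
      moreover have "openin X (W \<inter> W')" using W by (auto simp: G_def)
      moreover have "(U \<inter> U') \<inter> V \<subseteq> W \<inter> W'" using U by blast
      ultimately show ?thesis unfolding G_def by blast
    qed
    show "W' \<in> G" if "W \<in> G" "openin X W' \<and> W \<subseteq> W'" for W W'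
      using that unfolding G_def by blast
  qed
  moreover have "F \<subseteq> G" using open_filter_openin[OF filt] by (auto simp: G_def)
  ultimately have "G = F" using F unfolding open_ultrafilter_def by blast
  moreover have "V \<in> G" using V top by (auto simp: G_def)
  ultimately show ?thesis by blast
qed

lemma open_ultrafilterI:
  assumes F: "open_filter X F"
    and mem: "\<And>V. openin X V \<Longrightarrow> (\<And>U. U \<in> F \<Longrightarrow> U \<inter> V \<noteq> {}) \<Longrightarrow> V \<in> F"
  shows "open_ultrafilter X F"
  unfolding open_ultrafilter_def
proof (intro conjI allI impI F)
  fix G assume G: "open_filter X G \<and> F \<subseteq> G"
  have "V \<in> F" if "V \<in> G" for V
  proof (rule mem)
    show "openin X V" using G that open_filter_openin by blast
    show "U \<inter> V \<noteq> {}" if "U \<in> F" for U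
      using G that \<open>V \<in> G\<close> open_filter_Int open_filter_nonempty by (metis subsetD)
  qed
  then show "G = F" using G by blast
qed

text \<open>Adherence means that every neighbourhood meets every member of \<open>F\<close>; by
  maximality such a neighbourhood already belongs to \<open>F\<close>. So the adherent points of an
  open ultrafilter are exactly its limits.\<close>

lemma adherence_open_ultrafilter:
  assumes F: "open_ultrafilter X F"
  shows "adherence X F = {x \<in> topspace X. \<forall>V. openin X V \<and> x \<in> V \<longrightarrow> V \<in> F}"
proof (intro equalityI subsetI)
  note filt = open_ultrafilter_imp_open_filter[OF F]
  fix x assume x: "x \<in> adherence X F"
  then have "x \<in> topspace X"
    using open_filter_topspace[OF filt] by (auto simp: adherence_def)
  moreover have "V \<in> F" if "openin X V" "x \<in> V" for V
  proof (rule open_ultrafilter_memI[OF F])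
    fix U assume "U \<in> F"
    then have "x \<in> X closure_of U" using x by (auto simp: adherence_def)
    then show "U \<inter> V \<noteq> {}" using that by (auto simp: in_closure_of)
  qed (rule that)
  ultimately show "x \<in> {x \<in> topspace X. \<forall>V. openin X V \<and> x \<in> V \<longrightarrow> V \<in> F}" by blast
next
  note filt = open_ultrafilter_imp_open_filter[OF F]
  fix x assume x: "x \<in> {x \<in> topspace X. \<forall>V. openin X V \<and> x \<in> V \<longrightarrow> V \<in> F}"
  have "\<exists>y. y \<in> U \<and> y \<in> V" if "U \<in> F" "openin X V" "x \<in> V" for U V
  proof -
    have "U \<inter> V \<in> F" using that x open_filter_Int[OF filt] by simp
    then show ?thesis using open_filter_nonempty[OF filt] by blast
  qed
  then show "x \<in> adherence X F" using x by (auto simp: adherence_def in_closure_of)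
qed

text \<open>Zorn's lemma: in a union of a chain of open filters, any two members already lie in one
  filter of the chain.\<close>

lemma open_ultrafilter_extends:
  assumes "open_filter X F"
  obtains G where "open_ultrafilter X G" "F \<subseteq> G"
proof -
  let ?A = "{G. open_filter X G \<and> F \<subseteq> G}"
  have "\<exists>M\<in>?A. \<forall>G\<in>?A. M \<subseteq> G \<longrightarrow> G = M"
  proof (rule subset_Zorn_nonempty)
    show "?A \<noteq> {}" using assms by blast
    fix C assume C: "C \<noteq> {}" "subset.chain ?A C"
    have C_filt: "open_filter X G" "F \<subseteq> G" if "G \<in> C" for G
      using C(2) that by (auto simp: subset.chain_def)
    have "open_filter X (\<Union>C)"
      unfolding open_filter_def
    proof (intro conjI ballI allI impI)
      show "\<Union>C \<noteq> {}" using C(1) C_filt open_filter_topspace by blast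
      show "openin X U" "U \<noteq> {}" if "U \<in> \<Union>C" for U
        using that C_filt open_filter_openin open_filter_nonempty by blast+
      show "U \<inter> V \<in> \<Union>C" if UV: "U \<in> \<Union>C" "V \<in> \<Union>C" for U V
      proof -
        obtain G H where GH: "U \<in> G" "G \<in> C" "V \<in> H" "H \<in> C" using UV by blast
        then have "G \<subseteq> H \<or> H \<subseteq> G"
          using C(2) unfolding subset_chain_def by blast
        then obtain K where "K \<in> C" "U \<in> K" "V \<in> K" using GH by blast
        then show ?thesis using C_filt open_filter_Int by blast
      qed
      show "V \<in> \<Union>C" if "U \<in> \<Union>C" "openin X V \<and> U \<subseteq> V" for U V
        using that C_filt open_filter_superset by blast
    qed
    then show "\<Union>C \<in> ?A" using C(1) C_filt(2) by blast
  qed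
  then obtain M where M: "M \<in> ?A" "\<forall>G\<in>?A. M \<subseteq> G \<longrightarrow> G = M" by (rule bexE)
  have "open_ultrafilter X M"
    unfolding open_ultrafilter_def
  proof (intro conjI allI impI)
    show "open_filter X M" using M(1) by simp
    fix G assume G: "open_filter X G \<and> M \<subseteq> G"
    then have "G \<in> ?A" using M(1) by auto
    then show "G = M" using M(2) G by simp
  qed
  then show thesis using that M(1) by simp
qed

text \<open>Any open ultrafilter refining the open neighbourhoods of \<open>x\<close> converges to
  \<open>x\<close>.\<close>

lemma point_in_adherence:
  assumes "x \<in> topspace X"
  obtains F where "open_ultrafilter X F" "x \<in> adherence X F"
proof -
  have "open_filter X {U. openin X U \<and> x \<in> U}"
    using assms unfolding open_filter_def by blast
  then obtain F where "open_ultrafilter X F" "{U. openin X U \<and> x \<in> U} \<subseteq> F"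
    by (rule open_ultrafilter_extends)
  then show thesis using that assms by (auto simp: adherence_open_ultrafilter)
qed

section \<open>Adherences in n-Hausdorff and n-H-closed spaces\<close>

text \<open>Open sets separating \<open>n\<close> distinct limits of \<open>F\<close> would all
  belong to \<open>F\<close>, yet have empty intersection.\<close>

lemma adherence_n_Hausdorff:
  assumes X: "n_Hausdorff n X" and F: "open_ultrafilter X F" and n: "n \<ge> 1"
  shows "finite (adherence X F)" "card (adherence X F) \<le> n - 1"
proof -
  note filt = open_ultrafilter_imp_open_filter[OF F]
  \<comment> \<open>Excluding finite subsets with exactly \<open>n\<close> points yields both
    claims, since an infinite adherence would contain such a subset as well.\<close>
  have no: "\<not> (S \<subseteq> adherence X F \<and> finite S \<and> card S = n)" for S
  proof
    assume S: "S \<subseteq> adherence X F \<and> finite S \<and> card S = n"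
    then obtain x where x: "bij_betw x {1..n} S"
      using ex_bij_betw_nat_finite_1 by blast
    have "S \<subseteq> topspace X" using S by (auto simp: adherence_open_ultrafilter[OF F])
    then obtain U where U: "\<And>i. i \<in> {1..n} \<Longrightarrow> openin X (U i) \<and> x i \<in> U i"
        "(\<Inter>i\<in>{1..n}. U i) = {}"
      using X x unfolding n_Hausdorff_def bij_betw_def by metis
    have "U i \<in> F" if "i \<in> {1..n}" for i
    proof -
      have "x i \<in> adherence X F" using x that S by (auto simp: bij_betw_def)
      then show ?thesis using U(1)[OF that] by (auto simp: adherence_open_ultrafilter[OF F])
    qed
    then have "(\<Inter>i\<in>{1..n}. U i) \<in> F"
      using n by (intro open_filter_Inter[OF filt]) auto
    then show False using U(2) open_filter_nonempty[OF filt] by blast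
  qed
  show fin: "finite (adherence X F)"
    using no infinite_arbitrarily_large by blast
  show "card (adherence X F) \<le> n - 1"
  proof (rule ccontr)
    assume "\<not> ?thesis"
    then have "n \<le> card (adherence X F)" by simp
    then show False using no obtain_subset_with_card_n by metis
  qed
qed

text \<open>The space \<open>X\<close> with one new point \<open>None\<close>, a limit of the filter
  \<open>F\<close>. It lives on the option type so that it can serve as an ambient space in
  \<open>n_H_closed\<close>.\<close>

definition add_point :: "'a topology \<Rightarrow> 'a set set \<Rightarrow> 'a option topology" where
  "add_point X F = topology (\<lambda>V. V \<subseteq> insert None (Some ` topspace X) \<and>
     openin X (Some -` V) \<and> (None \<in> V \<longrightarrow> Some -` V \<in> F))"

lemma openin_add_point:
  assumes F: "open_filter X F"
  shows "openin (add_point X F) V \<longleftrightarrow> V \<subseteq> insert None (Some ` topspace X) \<and>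
     openin X (Some -` V) \<and> (None \<in> V \<longrightarrow> Some -` V \<in> F)"
proof -
  have "istopology (\<lambda>V. V \<subseteq> insert None (Some ` topspace X) \<and>
     openin X (Some -` V) \<and> (None \<in> V \<longrightarrow> Some -` V \<in> F))" (is "istopology ?P")
    unfolding istopology_def
  proof (rule conjI; intro allI impI)
    show "?P (S \<inter> T)" if "?P S" "?P T" for S T
      using that open_filter_Int[OF F] by (auto simp: vimage_Int)
  next
    fix \<K> assume K: "\<forall>V\<in>\<K>. ?P V"
    have op: "openin X (Some -` \<Union>\<K>)" unfolding vimage_Union using K by (intro openin_Union) blast
    have "Some -` \<Union>\<K> \<in> F" if "None \<in> \<Union>\<K>"
    proof -
      obtain V where "V \<in> \<K>" "None \<in> V" using \<open>None \<in> \<Union>\<K>\<close> by blast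
      then have "Some -` V \<in> F" "Some -` V \<subseteq> Some -` \<Union>\<K>" using K by blast+
      then show ?thesis using op open_filter_superset[OF F] by blast
    qed
    then show "?P (\<Union>\<K>)" using K op by blast
  qed
  then show ?thesis unfolding add_point_def by (simp add: topology_inverse')
qed

lemma topspace_add_point:
  assumes "open_filter X F"
  shows "topspace (add_point X F) = insert None (Some ` topspace X)"
proof (rule antisym)
  show "topspace (add_point X F) \<subseteq> insert None (Some ` topspace X)"
    using openin_add_point[OF assms] openin_topspace by blast
  have "Some -` insert None (Some ` topspace X) = topspace X" by auto
  then have "openin (add_point X F) (insert None (Some ` topspace X))"
    using open_filter_topspace[OF assms] by (simp add: openin_add_point[OF assms])
  then show "insert None (Some ` topspace X) \<subseteq> topspace (add_point X F)"
    by (rule openin_subset)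
qed

lemma openin_add_point_Some:
  assumes "open_filter X F" "openin X U"
  shows "openin (add_point X F) (Some ` U)"
  using assms openin_subset[OF assms(2)] by (auto simp: openin_add_point inj_vimage_image_eq)

lemma openin_add_point_insert_None:
  assumes F: "open_filter X F" and U: "U \<in> F"
  shows "openin (add_point X F) (insert None (Some ` U))"
proof -
  have "Some -` insert None (Some ` U) = U" by auto
  then show ?thesis
    using U openin_subset[OF open_filter_openin[OF F U]] open_filter_openin[OF F U]
    by (auto simp: openin_add_point[OF F])
qed

lemma embedding_map_add_point:
  assumes F: "open_filter X F"
  shows "embedding_map X (add_point X F) Some"
proof (rule injective_open_imp_embedding_map)
  show "continuous_map X (add_point X F) Some"
    unfolding continuous_map
  proof (intro conjI allI impI)
    show "Some ` topspace X \<subseteq> topspace (add_point X F)"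
      by (auto simp: topspace_add_point[OF F])
    fix V assume "openin (add_point X F) V"
    moreover then have "{x \<in> topspace X. Some x \<in> V} = Some -` V"
      by (auto simp: openin_add_point[OF F])
    ultimately show "openin X {x \<in> topspace X. Some x \<in> V}"
      by (simp add: openin_add_point[OF F])
  qed
  show "open_map X (add_point X F) Some"
    using openin_add_point_Some[OF F] by (simp add: open_map_def)
qed simp

text \<open>Only tuples containing \<open>None\<close> are critical. Their other
  \<open>n - 1\<close> points are too many to be all adherent to \<open>F\<close>, and a
  non-adherent one can be separated from \<open>None\<close> by disjoint open sets.\<close>

lemma n_Hausdorff_add_point:
  assumes X: "n_Hausdorff n X" and F: "open_ultrafilter X F"
    and fin: "finite (adherence X F)" and card: "card (adherence X F) < n - 1"
  shows "n_Hausdorff n (add_point X F)"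
  unfolding n_Hausdorff_def
proof (intro allI impI)
  note filt = open_ultrafilter_imp_open_filter[OF F]
  fix x assume x: "x ` {1..n} \<subseteq> topspace (add_point X F) \<and> inj_on x {1..n}"
  then have x_cases: "x i = None \<or> x i \<in> Some ` topspace X" if "i \<in> {1..n}" for i
    using that x unfolding topspace_add_point[OF filt] by blast
  show "\<exists>U. (\<forall>i\<in>{1..n}. openin (add_point X F) (U i) \<and> x i \<in> U i) \<and> (\<Inter>i\<in>{1..n}. U i) = {}"
  proof (cases "None \<in> x ` {1..n}")
    case False
    then have x_Some: "the (x i) \<in> topspace X" "x i = Some (the (x i))" if "i \<in> {1..n}" for i
      using x_cases[OF that] that by force+
    have "inj_on (the \<circ> x) {1..n}"
      using x x_Some(2) unfolding inj_on_def comp_def by metis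
    moreover have "(the \<circ> x) ` {1..n} \<subseteq> topspace X" using x_Some(1) by auto
    ultimately obtain U where U: "\<forall>i\<in>{1..n}. openin X (U i) \<and> (the \<circ> x) i \<in> U i"
        "(\<Inter>i\<in>{1..n}. U i) = {}"
      using X[unfolded n_Hausdorff_def, rule_format, of "the \<circ> x"] by blast
    have "openin (add_point X F) (Some ` U i) \<and> x i \<in> Some ` U i" if "i \<in> {1..n}" for i
      using U(1) that x_Some(2)[OF that] openin_add_point_Some[OF filt] by fastforce
    \<comment> \<open>The image commutes with the intersection because \<open>Some\<close> is
      injective and the index set is nonempty: \<open>card\<close> forces \<open>n\<close> to be at
      least 2.\<close>
    moreover have "(\<Inter>i\<in>{1..n}. Some ` U i) = Some ` (\<Inter>i\<in>{1..n}. U i)"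
      using card by (intro image_INT[of Some UNIV, symmetric]) auto
    ultimately show ?thesis using U(2) by (intro exI[of _ "\<lambda>i. Some ` U i"]) simp
  next
    case True
    then obtain m where m: "m \<in> {1..n}" "x m = None" by force
    let ?J = "{1..n} - {m}"
    have "card (x ` ?J) = n - 1"
      using x m(1) inj_on_subset[of x "{1..n}" ?J] by (subst card_image) auto
    then have "\<not> x ` ?J \<subseteq> Some ` adherence X F"
      using card card_mono[of "Some ` adherence X F" "x ` ?J"] fin
      by (auto simp: card_image)
    then obtain k where k: "k \<in> ?J" "x k \<notin> Some ` adherence X F" by blast
    have "x k \<noteq> None"
      using inj_onD[of x "{1..n}" k m] x m k(1) by auto
    then obtain z where z: "x k = Some z" "z \<in> topspace X" using x_cases[of k] k(1) by auto
    then have "z \<notin> adherence X F" using k(2) by blast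
    \<comment> \<open>Non-convergence at \<open>z\<close> gives a neighbourhood outside
      \<open>F\<close>; by maximality some member \<open>A\<close> of \<open>F\<close> misses it.
      Then \<open>A\<close> together with \<open>None\<close> is a neighbourhood of
      \<open>None\<close> disjoint from the copy of \<open>V\<close>.\<close>
    then obtain V where V: "openin X V" "z \<in> V" "V \<notin> F"
      using z(2) by (auto simp: adherence_open_ultrafilter[OF F])
    then obtain A where A: "A \<in> F" "A \<inter> V = {}"
      using open_ultrafilter_memI[OF F V(1)] by auto
    define U where "U = (\<lambda>i. if i = m then insert None (Some ` A) else
      if i = k then Some ` V else topspace (add_point X F))"
    have "openin (add_point X F) (U i) \<and> x i \<in> U i" if "i \<in> {1..n}" for i
      using that x m(2) z(1) V openin_add_point_Some[OF filt V(1)]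
        openin_add_point_insert_None[OF filt A(1)]
      by (auto simp: U_def)
    moreover have "U m \<inter> U k = {}" using k(1) A(2) by (auto simp: U_def)
    then have "(\<Inter>i\<in>{1..n}. U i) = {}" using m(1) k(1) by blast
    ultimately show ?thesis by blast
  qed
qed

text \<open>With fewer than \<open>n - 1\<close> adherent points, \<open>add_point X F\<close> would
  be an \<open>n\<close>-Hausdorff space in which \<open>X\<close> is embedded but not closed. The
  other inequality is the bound for \<open>n\<close>-Hausdorff spaces.\<close>

lemma adherence_n_H_closed:
  assumes X: "n_H_closed n X" and F: "open_ultrafilter X F" and n: "n \<ge> 1"
  shows "finite (adherence X F)" "card (adherence X F) = n - 1"
proof -
  note filt = open_ultrafilter_imp_open_filter[OF F]
  have haus: "n_Hausdorff n X" using X by (simp add: n_H_closed_def)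
  show fin: "finite (adherence X F)" using adherence_n_Hausdorff[OF haus F n] by blast
  have "\<not> card (adherence X F) < n - 1"
  proof
    assume "card (adherence X F) < n - 1"
    then have "n_Hausdorff n (add_point X F)"
      using n_Hausdorff_add_point[OF haus F fin] by blast
    then have "closedin (add_point X F) (Some ` topspace X)"
      using X embedding_map_add_point[OF filt] unfolding n_H_closed_def by blast
    \<comment> \<open>Closedness of the copy of \<open>X\<close> would isolate \<open>None\<close>,
      so that the empty trace of \<open>{None}\<close> would have to belong to
      \<open>F\<close>.\<close>
    then have "openin (add_point X F) (insert None (Some ` topspace X) - Some ` topspace X)"
      by (metis closedin_def topspace_add_point[OF filt])
    moreover have "insert None (Some ` topspace X) - Some ` topspace X = {None}" by auto
    ultimately have "Some -` {None} \<in> F" by (simp add: openin_add_point[OF filt])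
    then show False using open_filter_nonempty[OF filt] by force
  qed
  then show "card (adherence X F) = n - 1"
    using adherence_n_Hausdorff(2)[OF haus F n] by linarith
qed

section \<open>Ultrafilters on a dense subspace\<close>

text \<open>This is \<open>W \<inter> X\<close> when \<open>X\<close> is identified with its image.
  The restriction to \<open>topspace X\<close> is needed because \<open>j\<close> is unconstrained
  elsewhere.\<close>

definition trace_on :: "'a topology \<Rightarrow> ('a \<Rightarrow> 'b) \<Rightarrow> 'b set \<Rightarrow> 'a set" where
  "trace_on X j W = {x \<in> topspace X. j x \<in> W}"

definition push_filter ::
    "'a topology \<Rightarrow> 'b topology \<Rightarrow> ('a \<Rightarrow> 'b) \<Rightarrow> 'a set set \<Rightarrow> 'b set set" where
  "push_filter X Z j F = {W. openin Z W \<and> trace_on X j W \<in> F}"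

lemma trace_on_Int: "trace_on X j (V \<inter> W) = trace_on X j V \<inter> trace_on X j W"
  by (auto simp: trace_on_def)

lemma trace_on_mono: "V \<subseteq> W \<Longrightarrow> trace_on X j V \<subseteq> trace_on X j W"
  by (auto simp: trace_on_def)

context
  fixes X :: "'a topology" and Z :: "'b topology" and j :: "'a \<Rightarrow> 'b"
  assumes ext: "extension_via X Z j"
begin

lemma extension_continuous: "continuous_map X Z j"
  using ext continuous_map_in_subtopology homeomorphic_imp_continuous_map
  unfolding extension_via_def embedding_map_def by blast

lemma openin_trace_on: "openin Z W \<Longrightarrow> openin X (trace_on X j W)"
  unfolding trace_on_def using extension_continuous openin_continuous_map_preimage by blast

lemma trace_on_topspace: "trace_on X j (topspace Z) = topspace X"
  using extension_continuous unfolding trace_on_def continuous_map_def by blast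

text \<open>The image of \<open>U\<close> is relatively open in the image of \<open>X\<close>, and
  injectivity of \<open>j\<close> recovers \<open>U\<close> from it.\<close>

lemma openin_imp_trace_on:
  assumes U: "openin X U"
  obtains W where "openin Z W" "U = trace_on X j W"
proof -
  have hom: "homeomorphic_map X (subtopology Z (j ` topspace X)) j"
    using ext unfolding extension_via_def embedding_map_def by blast
  have inj: "inj_on j (topspace X)" using homeomorphic_imp_injective_map[OF hom] .
  have "openin (subtopology Z (j ` topspace X)) (j ` U)"
    using homeomorphic_imp_open_map[OF hom] U unfolding open_map_def by blast
  then obtain W where W: "openin Z W" "j ` U = W \<inter> j ` topspace X"
    by (auto simp: openin_subtopology)
  have "x \<in> U \<longleftrightarrow> j x \<in> W" if "x \<in> topspace X" for x
  proof -
    have "x \<in> U \<longleftrightarrow> j x \<in> j ` U"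
      using inj_on_image_mem_iff[OF inj that openin_subset[OF U]] by blast
    then show ?thesis using W(2) that by blast
  qed
  then have "U = trace_on X j W" using openin_subset[OF U] by (auto simp: trace_on_def)
  then show thesis using that W(1) by blast
qed

lemma trace_on_nonempty:
  assumes W: "openin Z W" "W \<noteq> {}"
  shows "trace_on X j W \<noteq> {}"
proof -
  obtain z where z: "z \<in> W" using W(2) by blast
  then have "z \<in> Z closure_of (j ` topspace X)"
    using ext openin_subset[OF W(1)] unfolding extension_via_def by blast
  then show ?thesis using z W(1) by (auto simp: in_closure_of trace_on_def)
qed

lemma open_filter_push:
  assumes F: "open_filter X F"
  shows "open_filter Z (push_filter X Z j F)"
  unfolding open_filter_def
proof (intro conjI ballI allI impI)
  have "topspace Z \<in> push_filter X Z j F"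
    using open_filter_topspace[OF F] by (simp add: push_filter_def trace_on_topspace)
  then show "push_filter X Z j F \<noteq> {}" by blast
  show "openin Z W" if "W \<in> push_filter X Z j F" for W
    using that by (simp add: push_filter_def)
  show "W \<noteq> {}" if "W \<in> push_filter X Z j F" for W
    using that open_filter_nonempty[OF F] by (auto simp: push_filter_def trace_on_def)
  show "V \<inter> W \<in> push_filter X Z j F"
    if "V \<in> push_filter X Z j F" "W \<in> push_filter X Z j F" for V W
    using that open_filter_Int[OF F] by (auto simp: push_filter_def trace_on_Int)
  show "V \<in> push_filter X Z j F"
    if "W \<in> push_filter X Z j F" "openin Z V \<and> W \<subseteq> V" for V W
    using that open_filter_superset[OF F _ openin_trace_on trace_on_mono]
    by (auto simp: push_filter_def)
qed

text \<open>If \<open>V\<close> meets every member of the pushed filter, then density makes the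
  trace of \<open>V\<close> meet every member of \<open>F\<close>, since each of these is the trace
  of an open set \<open>W\<close>. Maximality of \<open>F\<close> transfers along traces.\<close>

lemma open_ultrafilter_push:
  assumes F: "open_ultrafilter X F"
  shows "open_ultrafilter Z (push_filter X Z j F)"
proof (rule open_ultrafilterI)
  note filt = open_ultrafilter_imp_open_filter[OF F]
  show "open_filter Z (push_filter X Z j F)" by (rule open_filter_push[OF filt])
  fix V assume V: "openin Z V" and meets: "\<And>U. U \<in> push_filter X Z j F \<Longrightarrow> U \<inter> V \<noteq> {}"
  have "trace_on X j V \<in> F"
  proof (rule open_ultrafilter_memI[OF F openin_trace_on[OF V]])
    fix U assume U: "U \<in> F"
    then obtain W where W: "openin Z W" "U = trace_on X j W"
      using open_filter_openin[OF filt] openin_imp_trace_on by metis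
    then have "W \<inter> V \<noteq> {}" using meets U by (simp add: push_filter_def)
    then show "U \<inter> trace_on X j V \<noteq> {}"
      using trace_on_nonempty W V by (metis openin_Int trace_on_Int)
  qed
  then show "V \<in> push_filter X Z j F" using V by (simp add: push_filter_def)
qed

text \<open>The traces of the members of \<open>G\<close> form an open ultrafilter \<open>F\<close>
  on \<open>X\<close>. Its push contains \<open>G\<close>, hence equals \<open>G\<close> by
  maximality.\<close>

lemma open_ultrafilter_is_push:
  assumes G: "open_ultrafilter Z G"
  obtains F where "open_ultrafilter X F" "push_filter X Z j F = G"
proof -
  note filt = open_ultrafilter_imp_open_filter[OF G]
  define F where "F = trace_on X j ` G"
  have F: "open_filter X F"
    unfolding open_filter_def
  proof (intro conjI ballI allI impI)
    show "F \<noteq> {}" using open_filter_topspace[OF filt] by (auto simp: F_def)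
    show "openin X U" "U \<noteq> {}" if "U \<in> F" for U
      using that openin_trace_on trace_on_nonempty open_filter_openin[OF filt]
        open_filter_nonempty[OF filt] by (auto simp: F_def)
    show "U \<inter> V \<in> F" if "U \<in> F" "V \<in> F" for U V
      using that open_filter_Int[OF filt] by (auto simp: F_def simp flip: trace_on_Int)
    show "V \<in> F" if U: "U \<in> F" and V: "openin X V \<and> U \<subseteq> V" for U V
    proof -
      obtain W where W: "W \<in> G" "U = trace_on X j W" using U by (auto simp: F_def)
      obtain T where T: "openin Z T" "V = trace_on X j T" using V openin_imp_trace_on by metis
      \<comment> \<open>The set \<open>T\<close> need not contain \<open>W\<close>, but adding
        \<open>W\<close> to it does not change the trace, as \<open>U \<subseteq> V\<close>.\<close>
      have "W \<union> T \<in> G"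
        using T(1) W(1) open_filter_openin[OF filt W(1)]
        by (intro open_filter_superset[OF filt W(1)]) auto
      moreover have "trace_on X j (W \<union> T) = V" using W(2) T(2) V by (auto simp: trace_on_def)
      ultimately show ?thesis by (auto simp: F_def)
    qed
  qed
  have "open_ultrafilter X F"
  proof (rule open_ultrafilterI[OF F])
    fix V assume V: "openin X V" and meets: "\<And>U. U \<in> F \<Longrightarrow> U \<inter> V \<noteq> {}"
    obtain T where T: "openin Z T" "V = trace_on X j T" using V openin_imp_trace_on by metis
    have "T \<in> G"
    proof (rule open_ultrafilter_memI[OF G T(1)])
      fix W assume "W \<in> G"
      then have "trace_on X j W \<inter> V \<noteq> {}" using meets by (simp add: F_def)
      then show "W \<inter> T \<noteq> {}" using T(2) by (auto simp: trace_on_def)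
    qed
    then show "V \<in> F" using T(2) by (simp add: F_def)
  qed
  moreover have "G \<subseteq> push_filter X Z j F"
    using open_filter_openin[OF filt] by (auto simp: push_filter_def F_def)
  then have "push_filter X Z j F = G"
    using G open_filter_push[OF F] unfolding open_ultrafilter_def by blast
  ultimately show thesis by (rule that)
qed

text \<open>Open sets around \<open>x\<close> in \<open>X\<close> are precisely the traces of open
  sets around \<open>j x\<close> in \<open>Z\<close>, so convergence to the two points is the same
  condition.\<close>

lemma adherence_push:
  assumes F: "open_ultrafilter X F"
  shows "adherence Z (push_filter X Z j F) \<inter> j ` topspace X = j ` adherence X F"
proof -
  have "j x \<in> adherence Z (push_filter X Z j F) \<longleftrightarrow> x \<in> adherence X F" if x: "x \<in> topspace X" for x
  proof -
    have "j x \<in> topspace Z" using trace_on_topspace x by (auto simp: trace_on_def)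
    moreover have "(\<forall>W. openin Z W \<and> j x \<in> W \<longrightarrow> W \<in> push_filter X Z j F) \<longleftrightarrow>
        (\<forall>V. openin X V \<and> x \<in> V \<longrightarrow> V \<in> F)" (is "?L \<longleftrightarrow> ?R")
    proof
      assume L: ?L
      show ?R
      proof (intro allI impI)
        fix V assume V: "openin X V \<and> x \<in> V"
        then obtain W where "openin Z W" "V = trace_on X j W" using openin_imp_trace_on by metis
        then show "V \<in> F" using L V by (auto simp: push_filter_def trace_on_def)
      qed
    next
      assume ?R
      then show ?L using openin_trace_on x by (auto simp: push_filter_def trace_on_def)
    qed
    ultimately show ?thesis
      using x by (simp add: adherence_open_ultrafilter[OF F]
          adherence_open_ultrafilter[OF open_ultrafilter_push[OF F]])
  qed
  moreover have "adherence X F \<subseteq> topspace X" by (auto simp: adherence_open_ultrafilter[OF F])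
  ultimately show ?thesis by blast
qed

text \<open>The push has \<open>n - 1\<close> adherent points in \<open>Z\<close>, and those in the
  image of \<open>X\<close> correspond to the adherence of \<open>F\<close> via \<open>j\<close>.
  What remains is counted by the number of new points that the construction provides for
  \<open>F\<close>.\<close>

lemma card_adherence_push:
  assumes Z: "n_H_closed n Z" and F: "open_ultrafilter X F" and n: "n \<ge> 1"
  shows "finite (adherence X F)" "finite (adherence Z (push_filter X Z j F))"
    and "card (adherence X F) + card (adherence Z (push_filter X Z j F) - j ` topspace X) = n - 1"
proof -
  let ?A = "adherence Z (push_filter X Z j F)"
  note ad = adherence_n_H_closed[OF Z open_ultrafilter_push[OF F] n]
  show fin: "finite ?A" by (rule ad)
  have inj: "inj_on j (adherence X F)"
  proof (rule inj_on_subset)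
    show "inj_on j (topspace X)"
      using ext unfolding extension_via_def embedding_map_def
      using homeomorphic_imp_injective_map by blast
    show "adherence X F \<subseteq> topspace X" by (auto simp: adherence_open_ultrafilter[OF F])
  qed
  have "finite (j ` adherence X F)" using fin by (simp flip: adherence_push[OF F])
  then show "finite (adherence X F)" using inj by (rule finite_imageD)
  have "card (adherence X F) = card (?A \<inter> j ` topspace X)"
    using card_image[OF inj] by (simp add: adherence_push[OF F])
  then show "card (adherence X F) + card (?A - j ` topspace X) = n - 1"
    using card_Int_Diff[OF fin, of "j ` topspace X"] ad(2) by linarith
qed

end

section \<open>The surjection from the simple extension onto \<open>Z\<close>\<close>

theorem theorem5:
  fixes n :: nat and X :: "'a topology" and Z :: "'b topology" and j :: "'a \<Rightarrow> 'b"
  assumes "n \<ge> 2"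
    and "n_Hausdorff n X"
    and "n_H_closed n Z"
    and "extension_via X Z j"
  shows "\<exists>f. continuous_map (n_kappa n X) Z f \<and>
             f ` topspace (n_kappa n X) = topspace Z \<and>
             (\<forall>x\<in>topspace X. f (Inl x) = j x)"
proof -
  note ext = assms(4)
  have n: "n \<ge> 1" using assms(1) by simp
  let ?ad = "\<lambda>F. adherence Z (push_filter X Z j F)"
  \<comment> \<open>If \<open>F\<close> has all \<open>n - 1\<close> adherent points in
    \<open>X\<close>, both sets are empty, so \<open>h\<close> exists for every open ultrafilter and
    not only for the small ones.\<close>
  have "\<exists>h. bij_betw h {1..n - 1 - card (adherence X F)} (?ad F - j ` topspace X)"
    if "open_ultrafilter X F" for F
  proof -
    note c = card_adherence_push[OF ext assms(3) that n]
    have "card (?ad F - j ` topspace X) = n - 1 - card (adherence X F)" using c(3) by linarith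
    then show ?thesis using ex_bij_betw_nat_finite_1[of "?ad F - j ` topspace X"] c(2) by auto
  qed
  then obtain h where h: "\<And>F. open_ultrafilter X F \<Longrightarrow>
      bij_betw (h F) {1..n - 1 - card (adherence X F)} (?ad F - j ` topspace X)"
    by metis
  define f where "f = case_sum j (\<lambda>(F, i). h F i)"
  have f_simps [simp]: "f (Inl x) = j x" "f (Inr (F, i)) = h F i" for x F i
    by (simp_all add: f_def)
  have ultra: "open_ultrafilter X F" if "Inr (F, i) \<in> n_kappa_points n X" for F i
    using that by (auto simp: n_kappa_points_def small_ultrafilters_def)
  have h_ad: "h F i \<in> ?ad F" if "Inr (F, i) \<in> n_kappa_points n X" for F i
  proof -
    have "i \<in> {1..n - 1 - card (adherence X F)}" using that by (auto simp: n_kappa_points_def)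
    then show ?thesis using bij_betwE[OF h[OF ultra[OF that]]] by blast
  qed
  have j_top: "j x \<in> topspace Z" if "x \<in> topspace X" for x
    using trace_on_topspace[OF ext] that by (auto simp: trace_on_def)
  have ad_push: "?ad F = {z \<in> topspace Z. \<forall>V. openin Z V \<and> z \<in> V \<longrightarrow> V \<in> push_filter X Z j F}"
    if "open_ultrafilter X F" for F
    using adherence_open_ultrafilter[OF open_ultrafilter_push[OF ext that]] .
  have f_top: "f y \<in> topspace Z" if "y \<in> n_kappa_points n X" for y
  proof (cases y)
    case (Inl x)
    then show ?thesis using that j_top by (auto simp: n_kappa_points_def)
  next
    case (Inr p)
    then obtain F i where y: "y = Inr (F, i)" by (cases p) auto
    then show ?thesis using h_ad ad_push[OF ultra] that by auto
  qed
  have "continuous_map (n_kappa n X) Z f"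
    unfolding continuous_map topspace_n_kappa
  proof (intro conjI allI impI)
    show "f ` n_kappa_points n X \<subseteq> topspace Z" using f_top by blast
    fix V assume V: "openin Z V"
    let ?P = "{y \<in> n_kappa_points n X. f y \<in> V}"
    have P: "Inl -` ?P = trace_on X j V" by (auto simp: n_kappa_points_def trace_on_def)
    \<comment> \<open>A new point over \<open>F\<close> is sent to a limit of the push of
      \<open>F\<close>, so a neighbourhood \<open>V\<close> of the image lies in the push. This says
      exactly that its trace lies in \<open>F\<close>, as openness at the new point
      requires.\<close>
    have "trace_on X j V \<in> F" if "Inr (F, i) \<in> ?P" for F i
      using that V h_ad[of F i] ad_push[OF ultra, of F i] by (auto simp: push_filter_def)
    then show "openin (n_kappa n X) ?P"
      unfolding openin_n_kappa P using openin_trace_on[OF ext V] by blast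
  qed
  moreover have "z \<in> f ` n_kappa_points n X" if z: "z \<in> topspace Z" for z
  proof (cases "z \<in> j ` topspace X")
    case True
    then obtain x where "x \<in> topspace X" "z = f (Inl x)" by auto
    moreover then have "Inl x \<in> n_kappa_points n X" by (simp add: n_kappa_points_def)
    ultimately show ?thesis by blast
  next
    case False
    obtain G where G: "open_ultrafilter Z G" "z \<in> adherence Z G"
      using point_in_adherence[OF z] by blast
    then obtain F where F: "open_ultrafilter X F" "push_filter X Z j F = G"
      using open_ultrafilter_is_push[OF ext] by blast
    have "z \<in> ?ad F - j ` topspace X" using False G(2) F(2) by blast
    then obtain i where i: "i \<in> {1..n - 1 - card (adherence X F)}" "z = h F i"
      using bij_betw_imp_surj_on[OF h[OF F(1)]] by blast
    \<comment> \<open>The index range contains \<open>i\<close>, so it is nonempty, which forces the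
      adherence of \<open>F\<close> to have fewer than \<open>n - 1\<close> points.\<close>
    have "F \<in> small_ultrafilters n X"
      using F(1) i(1) card_adherence_push(1)[OF ext assms(3) F(1) n]
      by (auto simp: small_ultrafilters_def)
    then have "Inr (F, i) \<in> n_kappa_points n X" using i(1) by (auto simp: n_kappa_points_def)
    then show ?thesis using i(2) by force
  qed
  ultimately show ?thesis
    using f_top by (intro exI[of _ f]) (auto simp: topspace_n_kappa)
qed

end
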